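(* Let $p,q\in\mathbb{R}_+$ and consider the function $\mathbb{R}_+\ni\lambda\mapsto Q(\lambda,p,q)=\lambda^{q+1}-(p+1)\lambda^q+p$ of the one variable $\lambda$. If $p\cdot q\neq 1$, this function has a unique zero in $\mathbb{R}_+$ different from $1$; denote it $\lambda(p,q)$. If $p\cdot q=1$, its unique zero in $\mathbb{R}_+$ is $1$; in this case put $\lambda(p,q)=\lambda(p,1/p)=1$. Moreover, for all $p,q\in\mathbb{R}_+$: $$1<\frac{(p+1)q}{q+1}<\lambda(p,q)\quad\text{if and only if}\quad p\cdot q>1;$$ $$0<\lambda(p,q)<\frac{(p+1)q}{q+1}<1\quad\text{if and only if}\quad p\cdot q<1;$$ $$\lambda(p,q)<p+1.$$
   Context: $\mathbb{R}_+$ denotes the set of (strictly) positive real numbers. For $\lambda,p,q\in\mathbb{R}_+$, $Q(\lambda,p,q)=\lambda^{q+1}-(p+1)\lambda^q+p$ (real powers). *)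

theory Defs
  imports Complex_Main
begin

definition Q :: "real \<Rightarrow> real \<Rightarrow> real \<Rightarrow> real" where
  "Q l p q = l powr (q + 1) - (p + 1) * l powr q + p"

(* The description operator is meaningful only for positive p, q with p * q \<noteq> 1, where
   existence and uniqueness of the positive zero different from 1 are to be proved. *)
definition zero_Q :: "real \<Rightarrow> real \<Rightarrow> real" where
  "zero_Q p q = (if p * q = 1 then 1 else (THE l. 0 < l \<and> l \<noteq> 1 \<and> Q l p q = 0))"

end

(* Q(., p, q) has derivative (q + 1) l^(q - 1) (l - m) with m = (p + 1) q / (q + 1), so it strictly
   decreases up to m and strictly increases afterwards. As Q(1) = 0, the minimum Q(m) is negative
   unless m = 1, i.e. unless p q = 1; since Q(0) = Q(p + 1) = p > 0, the second zero lies on the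
   side of m opposite to 1. *)
theory Submission
  imports Defs
begin

text \<open>By convention \<open>0 powr a = 0\<close> for every \<open>a\<close>; for
  \<open>q > 0\<close> this agrees with the limit of \<open>Q l p q\<close> as \<open>l\<close>
  tends to 0 from the right.\<close>

lemma Q_0 [simp]: "Q 0 p q = p"
  by (simp add: Q_def)

lemma Q_1 [simp]: "Q 1 p q = 0"
  by (simp add: Q_def)

lemma Q_p_plus_1: "0 < p \<Longrightarrow> Q (p + 1) p q = p"
  by (simp add: Q_def powr_add)

text \<open>Both exponents are positive, so continuity extends to the endpoint 0, which
  \<open>DERIV_Q\<close> does not cover.\<close>

lemma continuous_on_Q:
  assumes "0 < q" and "S \<subseteq> {0..}"
  shows "continuous_on S (\<lambda>l. Q l p q)"
  unfolding Q_def using assms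
  by (intro continuous_on_diff continuous_on_add continuous_on_mult continuous_on_powr'
      continuous_on_const continuous_on_id) auto

lemma DERIV_Q:
  assumes "0 < q" and "0 < l"
  shows "((\<lambda>l. Q l p q) has_real_derivative
    (q + 1) * l powr (q - 1) * (l - (p + 1) * q / (q + 1))) (at l)"
proof -
  have "l powr q = l powr (q - 1) * l"
    using assms(2) by (simp add: powr_diff)
  then have eq: "(q + 1) * l powr q - (p + 1) * (q * l powr (q - 1))
      = (q + 1) * l powr (q - 1) * (l - (p + 1) * q / (q + 1))"
    using assms(1) by (simp add: field_simps)
  have "((\<lambda>l. Q l p q) has_real_derivative
      (q + 1) * l powr q - (p + 1) * (q * l powr (q - 1))) (at l)"
    unfolding Q_def using assms by (auto intro!: derivative_eq_intros)
  then show ?thesis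
    by (simp only: eq)
qed

lemma Q_strict_antimono:
  assumes "0 < q" and "0 \<le> x" and "x < y" and "y \<le> (p + 1) * q / (q + 1)"
  shows "Q y p q < Q x p q"
\<comment> \<open>The criterion asks for the derivative only strictly between \<open>x\<close> and
  \<open>y\<close>, which admits \<open>x = 0\<close> and a vanishing derivative at the right
  end.\<close>
proof (rule DERIV_neg_imp_decreasing_open[OF assms(3)])
  fix l assume "x < l" "l < y"
  then have "0 < l"
    using assms by linarith
  have "(q + 1) * l powr (q - 1) * (l - (p + 1) * q / (q + 1)) < 0"
    using assms \<open>x < l\<close> \<open>l < y\<close> \<open>0 < l\<close> by (intro mult_pos_neg mult_pos_pos) auto
  then show "\<exists>D. DERIV (\<lambda>l. Q l p q) l :> D \<and> D < 0"
    using DERIV_Q[OF assms(1) \<open>0 < l\<close>] by blast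
qed (use assms in \<open>auto intro!: continuous_on_Q\<close>)

lemma Q_strict_mono:
  assumes "0 < p" and "0 < q" and "x < y" and "(p + 1) * q / (q + 1) \<le> x"
  shows "Q x p q < Q y p q"
proof -
  have "0 < (p + 1) * q / (q + 1)"
    using assms(1,2) by simp
  then have x: "0 < x"
    using assms(4) by linarith
  show ?thesis
  proof (rule DERIV_pos_imp_increasing_open[OF assms(3)])
    fix l assume "x < l" "l < y"
    then have "0 < l"
      using assms x by linarith
    have "(q + 1) * l powr (q - 1) * (l - (p + 1) * q / (q + 1)) > 0"
      using assms \<open>x < l\<close> \<open>l < y\<close> \<open>0 < l\<close> by (intro mult_pos_pos) auto
    then show "\<exists>D. DERIV (\<lambda>l. Q l p q) l :> D \<and> D > 0"
      using DERIV_Q[OF assms(2) \<open>0 < l\<close>] by blast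
  qed (use assms x in \<open>auto intro!: continuous_on_Q\<close>)
qed

lemma Q_zero_gt:
  assumes "0 < p" and "0 < q" and "1 < (p + 1) * q / (q + 1)"
  shows "\<exists>l. (p + 1) * q / (q + 1) < l \<and> l < p + 1 \<and> Q l p q = 0
    \<and> (\<forall>k. 0 < k \<and> k \<noteq> 1 \<and> Q k p q = 0 \<longrightarrow> k = l)"
proof -
  define m where "m = (p + 1) * q / (q + 1)"
  have anti: "Q y p q < Q x p q" if "0 \<le> x" "x < y" "y \<le> m" for x y
    using Q_strict_antimono that assms(2) by (simp add: m_def)
  have mono: "Q x p q < Q y p q" if "x < y" "m \<le> x" for x y
    using Q_strict_mono that assms(1,2) by (simp add: m_def)
  \<comment> \<open>The second bound holds because \<open>q / (q + 1) < 1\<close>.\<close>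
  have m1: "1 < m" and mp: "m < p + 1"
    using assms by (simp_all add: m_def field_simps)
  have Qm: "Q m p q < 0"
    using anti[of 1 m] m1 by simp
  have Qp: "0 < Q (p + 1) p q"
    using Q_p_plus_1 assms(1) by simp
  have "\<exists>l\<ge>m. l \<le> p + 1 \<and> Q l p q = 0"
    using Qm Qp mp m1 by (intro IVT' continuous_on_Q[OF assms(2)]) auto
  then obtain l where l: "m \<le> l" "l \<le> p + 1" "Q l p q = 0"
    by blast
  \<comment> \<open>\<open>Q\<close> is nonzero at both ends of the bracket, so the bounds on the
    zero are strict.\<close>
  have "m < l" "l < p + 1"
    using l Qm Qp by (auto simp: order_less_le)
  moreover have "k = l" if "0 < k" "k \<noteq> 1" "Q k p q = 0" for k
  proof (rule ccontr)
    assume "k \<noteq> l"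
    then show False
      \<comment> \<open>A zero \<open>k \<le> m\<close> is compared with the zero 1 on the
        decreasing branch, a zero \<open>k > m\<close> with \<open>l\<close> on the increasing
        one.\<close>
      using anti[of k 1] anti[of 1 k] mono[of k l] mono[of l k] that l m1 by (smt (verit) Q_1)
  qed
  ultimately show ?thesis
    using l(3) unfolding m_def by blast
qed

text \<open>Mirror image of \<open>Q_zero_gt\<close>: now 1 lies on the increasing branch, and the
  other zero is bracketed by 0, where \<open>Q\<close> equals \<open>p > 0\<close>, and the
  minimum.\<close>

lemma Q_zero_lt:
  assumes "0 < p" and "0 < q" and "(p + 1) * q / (q + 1) < 1"
  shows "\<exists>l. 0 < l \<and> l < (p + 1) * q / (q + 1) \<and> Q l p q = 0
    \<and> (\<forall>k. 0 < k \<and> k \<noteq> 1 \<and> Q k p q = 0 \<longrightarrow> k = l)"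
proof -
  define m where "m = (p + 1) * q / (q + 1)"
  have anti: "Q y p q < Q x p q" if "0 \<le> x" "x < y" "y \<le> m" for x y
    using Q_strict_antimono that assms(2) by (simp add: m_def)
  have mono: "Q x p q < Q y p q" if "x < y" "m \<le> x" for x y
    using Q_strict_mono that assms(1,2) by (simp add: m_def)
  have m0: "0 < m" and m1: "m < 1"
    using assms by (simp_all add: m_def)
  have Qm: "Q m p q < 0"
    using mono[of m 1] m1 by simp
  have "\<exists>l\<ge>0. l \<le> m \<and> Q l p q = 0"
    using Qm m0 assms(1) by (intro IVT2' continuous_on_Q[OF assms(2)]) auto
  then obtain l where l: "0 \<le> l" "l \<le> m" "Q l p q = 0"
    by blast
  have "0 < l" "l < m"
    using l Qm assms(1) by (auto simp: order_less_le)
  moreover have "k = l" if "0 < k" "k \<noteq> 1" "Q k p q = 0" for k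
  proof (rule ccontr)
    assume "k \<noteq> l"
    then show False
      using mono[of k 1] mono[of 1 k] anti[of k l] anti[of l k] that l m1 by (smt (verit) Q_1)
  qed
  ultimately show ?thesis
    using l(3) unfolding m_def by blast
qed

theorem proposition2p1:
  fixes p q :: real
  assumes "0 < p" and "0 < q"
  shows "(p * q \<noteq> 1 \<longrightarrow> (\<exists>!l. 0 < l \<and> l \<noteq> 1 \<and> Q l p q = 0))
    \<and> (p * q = 1 \<longrightarrow> {l. 0 < l \<and> Q l p q = 0} = {1})
    \<and> ((1 < (p + 1) * q / (q + 1) \<and> (p + 1) * q / (q + 1) < zero_Q p q) \<longleftrightarrow> p * q > 1)
    \<and> ((0 < zero_Q p q \<and> zero_Q p q < (p + 1) * q / (q + 1) \<and> (p + 1) * q / (q + 1) < 1)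
         \<longleftrightarrow> p * q < 1)
    \<and> zero_Q p q < p + 1"
proof -
  define m where "m = (p + 1) * q / (q + 1)"
  \<comment> \<open>Both equivalences come from
    \<open>m - 1 = (p * q - 1) / (q + 1)\<close>.\<close>
  have gt: "1 < m \<longleftrightarrow> 1 < p * q" and lt: "m < 1 \<longleftrightarrow> p * q < 1"
    using assms by (auto simp: m_def field_simps)
  have unique: "zero_Q p q = l" "\<exists>!l. 0 < l \<and> l \<noteq> 1 \<and> Q l p q = 0"
    if "p * q \<noteq> 1" "0 < l" "l \<noteq> 1" "Q l p q = 0"
      "\<forall>k. 0 < k \<and> k \<noteq> 1 \<and> Q k p q = 0 \<longrightarrow> k = l" for l
  proof -
    have "(THE l. 0 < l \<and> l \<noteq> 1 \<and> Q l p q = 0) = l"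
      using that by (intro the_equality) blast+
    then show "zero_Q p q = l"
      using that(1) by (simp add: zero_Q_def)
    show "\<exists>!l. 0 < l \<and> l \<noteq> 1 \<and> Q l p q = 0"
      using that by blast
  qed
  consider "p * q > 1" | "p * q < 1" | "p * q = 1"
    by linarith
  then show ?thesis
  proof cases
    case 1
    obtain l where l: "m < l" "l < p + 1" "Q l p q = 0"
      "\<forall>k. 0 < k \<and> k \<noteq> 1 \<and> Q k p q = 0 \<longrightarrow> k = l"
      using Q_zero_gt[OF assms] 1 gt unfolding m_def by blast
    have *: "p * q \<noteq> 1" "0 < l" "l \<noteq> 1"
      using l(1,2) 1 gt by auto
    show ?thesis
      \<comment> \<open>In the equivalence for \<open>p * q < 1\<close> both sides fail, as
        \<open>m > 1\<close>.\<close>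
      using unique[OF * l(3,4)] l(1,2) 1 gt assms(1)
      unfolding m_def[symmetric] by auto
  next
    case 2
    obtain l where l: "0 < l" "l < m" "Q l p q = 0"
      "\<forall>k. 0 < k \<and> k \<noteq> 1 \<and> Q k p q = 0 \<longrightarrow> k = l"
      using Q_zero_lt[OF assms] 2 lt unfolding m_def by blast
    have *: "p * q \<noteq> 1" "l \<noteq> 1"
      using l(1,2) 2 lt by auto
    show ?thesis
      \<comment> \<open>The bound by \<open>p + 1\<close> follows here from
        \<open>l < m < 1\<close>.\<close>
      using unique[OF *(1) l(1) *(2) l(3,4)] l(1,2) 2 lt assms(1)
      unfolding m_def[symmetric] by auto
  next
    case 3
    then have m1: "(p + 1) * q / (q + 1) = 1"
      using gt lt unfolding m_def by linarith
    \<comment> \<open>The minimum now sits at 1 with value 0, so \<open>Q\<close> is strictly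
      positive at every other positive point.\<close>
    have "l = 1" if "0 < l" "Q l p q = 0" for l
      using Q_strict_antimono[of q l 1 p] Q_strict_mono[of p q 1 l] m1 that assms
      by (cases l "1::real" rule: linorder_cases) auto
    then have "{l. 0 < l \<and> Q l p q = 0} = {1}"
      by auto
    then show ?thesis
      using 3 m1 assms(1) by (simp add: zero_Q_def)
  qed
qed

end
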